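(* (Sign Condition) Let $P$ be a finite collection of finite sets, ordered by inclusion. If $P$ does not have any signings, then $P$ is not the factor poset of any frame of nonzero vectors in $\mathbb{R}^n$, for any $n\ge 2$.
   Context: A frame for $\mathbb{R}^n$ is a finite sequence $\{f_i\}_{i\in I'}$ (repetitions allowed) spanning $\mathbb{R}^n$. It is tight if there is $\lambda>0$ with $\sum_i|\langle x,f_i\rangle|^2=\lambda\|x\|^2$ for all $x\in\mathbb{R}^n$. The factor poset of a frame $F=\{f_i\}_{i\in I'}$ is $\mathbb{F}_F=\{J\subseteq I':\{f_j\}_{j\in J}\text{ is a tight frame for }\mathbb{R}^n\}$, ordered by inclusion, with the convention $\emptyset\in\mathbb{F}_F$. A signing of a poset $P$ of sets with index set $I=\bigcup_{A\in P}A$ is a function from $I$ to $\{+,-\}$ such that every nonempty element of $P$ contains at least one index with positive sign and at least one index with negative sign. *)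

theory Defs
  imports "HOL-Analysis.Analysis"
begin

text \<open>
  A finite sequence of vectors (repetitions allowed) is a family \<open>f\<close> together with a
  finite index set \<open>I\<close>; only the values of \<open>f\<close> on \<open>I\<close> matter.
\<close>

definition is_frame :: "'i set \<Rightarrow> ('i \<Rightarrow> 'a::euclidean_space) \<Rightarrow> bool" where
  "is_frame I f \<longleftrightarrow> finite I \<and> span (f ` I) = UNIV"

definition is_tight_frame :: "'i set \<Rightarrow> ('i \<Rightarrow> 'a::euclidean_space) \<Rightarrow> bool" where
  "is_tight_frame I f \<longleftrightarrow> is_frame I f \<and>
     (\<exists>c>0. \<forall>x. (\<Sum>i\<in>I. \<bar>x \<bullet> f i\<bar>\<^sup>2) = c * (norm x)\<^sup>2)"

text \<open>The empty set belongs to the factor poset by convention. The order is \<open>(\<subseteq>)\<close>.\<close>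

definition factor_poset :: "'i set \<Rightarrow> ('i \<Rightarrow> 'a::euclidean_space) \<Rightarrow> 'i set set" where
  "factor_poset I f = {J. J \<subseteq> I \<and> (J = {} \<or> is_tight_frame J f)}"

datatype sign_value = Pos | Neg

text \<open>A signing has domain \<open>\<Union>P\<close>; the values of \<open>s\<close> outside this set are irrelevant.\<close>

definition is_signing :: "'i set set \<Rightarrow> ('i \<Rightarrow> sign_value) \<Rightarrow> bool" where
  "is_signing P s \<longleftrightarrow>
     (\<forall>A\<in>P. A \<noteq> {} \<longrightarrow> (\<exists>i\<in>A. s i = Pos) \<and> (\<exists>i\<in>A. s i = Neg))"

end

(* For a tight frame, polarization turns the frame identity into
   sum_j (a . f_j) (b . f_j) = c (a . b). Choose orthogonal vectors a and b that are not orthogonal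
   to any of the finitely many nonzero f_i. Then over every tight subframe the nonzero numbers
   (a . f_j) (b . f_j) sum to 0, so both signs occur, and sgn ((a . f_i) (b . f_i)) is a signing. *)
theory Submission
  imports Defs
begin

text \<open>A real vector space is not a finite union of proper subspaces. If \<open>x\<close> works
  for \<open>G\<close> and \<open>y\<close> works for the new element \<open>h\<close>, then on the
  line \<open>y + t x\<close> each hyperplane excludes at most one \<open>t\<close>, and there are
  infinitely many reals.\<close>

lemma subspace_avoids_finite_hyperplanes:
  fixes S G :: "'a::real_inner set"
  assumes "subspace S" "finite G" "\<And>g. g \<in> G \<Longrightarrow> \<exists>x\<in>S. x \<bullet> g \<noteq> 0"
  shows "\<exists>x\<in>S. \<forall>g\<in>G. x \<bullet> g \<noteq> 0"
  using assms(2,3)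
proof (induction G rule: finite_induct)
  case empty
  then show ?case using subspace_0[OF assms(1)] by blast
next
  case (insert h G)
  then obtain x where x: "x \<in> S" "\<forall>g\<in>G. x \<bullet> g \<noteq> 0" by auto
  from insert.prems obtain y where y: "y \<in> S" "y \<bullet> h \<noteq> 0" by blast
  (* The roots t of (y + t x) . g = 0; for g = h with x . h = 0 there is no root, and the
     junk value 0 is excluded harmlessly. *)
  define B where "B = (\<lambda>g. - (y \<bullet> g) / (x \<bullet> g)) ` insert h G"
  have "finite B" using insert.hyps by (simp add: B_def)
  then obtain t where t: "t \<notin> B"
    using ex_new_if_finite infinite_UNIV_char_0 by blast
  have "(y + t *\<^sub>R x) \<bullet> g \<noteq> 0" if "g \<in> insert h G" for g
  proof (cases "x \<bullet> g = 0")
    case True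
    then show ?thesis using that x y by (auto simp: inner_left_distrib)
  next
    case False
    have "t \<noteq> - (y \<bullet> g) / (x \<bullet> g)" using t that unfolding B_def by blast
    then show ?thesis using False by (auto simp: inner_left_distrib field_simps)
  qed
  moreover have "y + t *\<^sub>R x \<in> S"
    using x y assms(1) by (simp add: subspace_add subspace_scale)
  ultimately show ?case by blast
qed

text \<open>First \<open>a\<close> is chosen, then \<open>b\<close> inside the hyperplane orthogonal
  to \<open>a\<close>. The second choice is possible only if no \<open>g\<close> in \<open>G\<close>
  is parallel to \<open>a\<close>, so the first choice must ensure this as well.\<close>

lemma orthogonal_pair_avoiding_hyperplanes:
  fixes G :: "'a::euclidean_space set"
  assumes "finite G" "0 \<notin> G" "2 \<le> DIM('a)"
  obtains a b where "a \<bullet> b = 0" "\<And>g. g \<in> G \<Longrightarrow> a \<bullet> g \<noteq> 0" "\<And>g. g \<in> G \<Longrightarrow> b \<bullet> g \<noteq> 0"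
proof -
  have "\<exists>y. y \<noteq> 0 \<and> y \<bullet> g = 0" for g :: 'a
    using orthogonal_to_vector_exists[OF assms(3), of g]
    by (metis inner_commute orthogonal_def)
  then obtain p :: "'a \<Rightarrow> 'a" where p: "\<And>g. p g \<noteq> 0" "\<And>g. p g \<bullet> g = 0" by metis
  have "\<exists>x\<in>UNIV. \<forall>g\<in>G \<union> p ` G. x \<bullet> g \<noteq> 0"
  proof (rule subspace_avoids_finite_hyperplanes)
    show "finite (G \<union> p ` G)" using assms by simp
    fix g assume "g \<in> G \<union> p ` G"
    then have "g \<bullet> g \<noteq> 0" using assms p by auto
    then show "\<exists>x\<in>UNIV. x \<bullet> g \<noteq> 0" by blast
  qed simp
  then obtain a where a: "\<forall>g\<in>G. a \<bullet> g \<noteq> 0" "\<forall>g\<in>G. a \<bullet> p g \<noteq> 0" by blast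
  have "\<exists>x\<in>{x. a \<bullet> x = 0}. \<forall>g\<in>G. x \<bullet> g \<noteq> 0"
  proof (rule subspace_avoids_finite_hyperplanes[OF subspace_hyperplane assms(1)])
    fix g assume g: "g \<in> G"
    \<comment> \<open>This moves \<open>g\<close> along \<open>p g\<close> into the hyperplane
      orthogonal to \<open>a\<close>. Since \<open>p g\<close> is orthogonal to \<open>g\<close>,
      the value \<open>x \<bullet> g = g \<bullet> g\<close> stays nonzero.\<close>
    define x where "x = g - ((a \<bullet> g) / (a \<bullet> p g)) *\<^sub>R p g"
    have "a \<bullet> x = 0" using a g by (simp add: x_def inner_diff_right)
    moreover have "x \<bullet> g \<noteq> 0" using g assms p by (auto simp: x_def inner_diff_left)
    ultimately show "\<exists>x\<in>{x. a \<bullet> x = 0}. x \<bullet> g \<noteq> 0" by blast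
  qed
  then show ?thesis using that a by blast
qed

lemma tight_frame_polarization:
  fixes f :: "'i \<Rightarrow> 'a::euclidean_space"
  assumes "\<And>x. (\<Sum>i\<in>J. \<bar>x \<bullet> f i\<bar>\<^sup>2) = c * (norm x)\<^sup>2"
  shows "(\<Sum>i\<in>J. (a \<bullet> f i) * (b \<bullet> f i)) = c * (a \<bullet> b)"
proof -
  have "4 * (\<Sum>i\<in>J. (a \<bullet> f i) * (b \<bullet> f i))
      = (\<Sum>i\<in>J. \<bar>(a + b) \<bullet> f i\<bar>\<^sup>2) - (\<Sum>i\<in>J. \<bar>(a - b) \<bullet> f i\<bar>\<^sup>2)"
    \<comment> \<open>Termwise, this is \<open>4 * u * v = (u + v)^2 - (u - v)^2\<close>; the same
      identity for the norm gives the next step.\<close>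
    unfolding sum_distrib_left sum_subtractf[symmetric]
    by (rule sum.cong)
      (simp_all add: inner_left_distrib inner_diff_left power2_eq_square algebra_simps)
  also have "\<dots> = 4 * (c * (a \<bullet> b))"
    unfolding assms
    by (simp add: power2_norm_eq_inner inner_left_distrib inner_right_distrib inner_diff_left
        inner_diff_right inner_commute algebra_simps)
  finally show ?thesis by simp
qed

lemma sum_zero_both_signs:
  fixes w :: "'i \<Rightarrow> real"
  assumes "finite J" "J \<noteq> {}" "\<And>i. i \<in> J \<Longrightarrow> w i \<noteq> 0" "sum w J = 0"
  shows "\<exists>i\<in>J. 0 < w i" "\<exists>i\<in>J. w i < 0"
proof -
  show "\<exists>i\<in>J. 0 < w i"
  proof (rule ccontr)
    assume "\<not> ?thesis"
    \<comment> \<open>Without a positive term all terms are strictly negative, as none is zero, and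
      \<open>J\<close> is nonempty.\<close>
    then have "sum w J < sum (\<lambda>_. 0) J"
      using assms by (intro sum_strict_mono) (auto simp: not_less order_less_le)
    then show False using assms by simp
  qed
  show "\<exists>i\<in>J. w i < 0"
  proof (rule ccontr)
    assume "\<not> ?thesis"
    then have "sum (\<lambda>_. 0) J < sum w J"
      using assms by (intro sum_strict_mono) (auto simp: not_less order_less_le)
    then show False using assms by simp
  qed
qed

lemma factor_poset_has_signing:
  fixes f :: "'i \<Rightarrow> 'a::euclidean_space"
  assumes "finite I" "\<forall>i\<in>I. f i \<noteq> 0" "2 \<le> DIM('a)"
  shows "\<exists>s. is_signing (factor_poset I f) s"
proof -
  have "finite (f ` I)" "0 \<notin> f ` I" using assms by auto
  then obtain a b where ab: "a \<bullet> b = 0" "\<And>i. i \<in> I \<Longrightarrow> a \<bullet> f i \<noteq> 0" "\<And>i. i \<in> I \<Longrightarrow> b \<bullet> f i \<noteq> 0"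
    using orthogonal_pair_avoiding_hyperplanes[OF _ _ assms(3)] by (metis image_eqI)
  define w where "w i = (a \<bullet> f i) * (b \<bullet> f i)" for i
  \<comment> \<open>One pair \<open>a\<close>, \<open>b\<close> serves all of \<open>I\<close>, so
    \<open>s\<close> does not depend on \<open>J\<close>. The case \<open>w i = 0\<close>, sent to
    \<open>Neg\<close>, never occurs for \<open>i\<close> in \<open>I\<close>.\<close>
  define s where "s i = (if 0 < w i then Pos else Neg)" for i
  have "(\<exists>i\<in>J. s i = Pos) \<and> (\<exists>i\<in>J. s i = Neg)" if "J \<in> factor_poset I f" and ne: "J \<noteq> {}" for J
  proof -
    have J: "J \<subseteq> I" "is_tight_frame J f" using that by (auto simp: factor_poset_def)
    then obtain c where c: "\<And>x. (\<Sum>i\<in>J. \<bar>x \<bullet> f i\<bar>\<^sup>2) = c * (norm x)\<^sup>2"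
      unfolding is_tight_frame_def by blast
    have sum0: "sum w J = 0"
      unfolding w_def tight_frame_polarization[OF c] ab(1) by simp
    have fin: "finite J" using J(1) assms(1) by (rule finite_subset)
    have nz: "w i \<noteq> 0" if "i \<in> J" for i using that J(1) ab by (auto simp: w_def)
    obtain i j where "i \<in> J" "0 < w i" "j \<in> J" "w j < 0"
      using sum_zero_both_signs[OF fin ne nz sum0] by blast
    then have "s i = Pos" "s j = Neg" by (auto simp: s_def)
    then show ?thesis using \<open>i \<in> J\<close> \<open>j \<in> J\<close> by blast
  qed
  then show ?thesis unfolding is_signing_def by blast
qed

theorem corollary1:
  fixes P :: "'i set set"
  assumes "finite P"
    and "\<forall>A\<in>P. finite A"
    and "\<not> (\<exists>s. is_signing P s)"
    and "CARD('n::finite) \<ge> 2"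
  shows "\<not> (\<exists>I (f :: 'i \<Rightarrow> real ^ 'n).
           is_frame I f \<and> (\<forall>i\<in>I. f i \<noteq> 0) \<and> P = factor_poset I f)"
proof
  assume "\<exists>I (f :: 'i \<Rightarrow> real ^ 'n).
           is_frame I f \<and> (\<forall>i\<in>I. f i \<noteq> 0) \<and> P = factor_poset I f"
  then obtain I and f :: "'i \<Rightarrow> real ^ 'n"
    where "finite I" "\<forall>i\<in>I. f i \<noteq> 0" "P = factor_poset I f"
    unfolding is_frame_def by blast
  moreover have "2 \<le> DIM(real ^ 'n)" using assms(4) by simp
  ultimately show False using factor_poset_has_signing assms(3) by blast
qed

end
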